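(* Let $0<\alpha<1$ and let $S_\alpha$ be the $\alpha$-stable random walk on $\mathbb{Z}$. Let $\mathcal{A}=\{a_n:n\in\mathbb{N}\}$ be a strictly increasing sequence of positive integers which is superlinear, i.e. $a_n\geq a_{n-k}+a_k$ for all $0<k<n$. Then the set $\mathcal{A}$ is $S_\alpha$-massive if and only if $$\sum_{n\geq 1}\frac{1}{a_n^{1-\alpha}}=\infty .$$
   Context: Let $S$ be the symmetric simple random walk on $\mathbb{Z}^d$, with transition operator $P$. For $0<\alpha<2$, the $\alpha$-stable random walk $S_\alpha$ is the random walk on $\mathbb{Z}^d$ with transition operator $P_\alpha=I-(I-P)^{\alpha/2}=\sum_{k\geq1}c_k P^k$, where $c_k=(-1)^{k+1}\binom{\alpha/2}{k}\geq 0$ and $\sum_k c_k=1$; equivalently $S_\alpha(n)=S(\tau_n)$ where $\tau$ is an independent random walk on $\mathbb{Z}^+$ (a discrete $\alpha/2$-stable subordinator) with $\mathbb{E}[s^{\tau_1}]=1-(1-s)^{\alpha/2}$. For $d=1$ and $0<\alpha<1$ the walk $S_\alpha$ is transient. A set $B\subset\mathbb{Z}^d$ is called $S_\alpha$-massive (recurrent) if for every starting point $x\in\mathbb{Z}^d$ the walk $S_\alpha$ started at $x$ hits $B$ with probability $1$, and non-massive otherwise. *)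

theory Defs
  imports "HOL-Probability.Probability"
begin

text \<open>Coefficients c_k = (-1)^(k+1) * binom(alpha/2, k) of P_alpha = I - (I - P)^(alpha/2).\<close>
definition stable_coeff :: "real \<Rightarrow> nat \<Rightarrow> real" where
  "stable_coeff \<alpha> k = (-1) ^ (k + 1) * ((\<alpha> / 2) gchoose k)"

definition srw_step_prob :: "nat \<Rightarrow> int \<Rightarrow> real" where
  "srw_step_prob k z =
     (if \<bar>z\<bar> \<le> int k \<and> even (int k + z)
      then real (k choose nat ((int k + z) div 2)) / 2 ^ k else 0)"

definition stable_step_prob :: "real \<Rightarrow> int \<Rightarrow> real" where
  "stable_step_prob \<alpha> z = (\<Sum>k. stable_coeff \<alpha> (Suc k) * srw_step_prob (Suc k) z)"

definition stable_incr :: "real \<Rightarrow> int pmf" where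
  "stable_incr \<alpha> = embed_pmf (stable_step_prob \<alpha>)"

definition stable_walk_space :: "real \<Rightarrow> int stream measure" where
  "stable_walk_space \<alpha> = stream_space (measure_pmf (stable_incr \<alpha>))"

definition walk_pos :: "int \<Rightarrow> int stream \<Rightarrow> nat \<Rightarrow> int" where
  "walk_pos x \<omega> n = x + sum_list (stake n \<omega>)"

definition stable_massive :: "real \<Rightarrow> int set \<Rightarrow> bool" where
  "stable_massive \<alpha> B \<longleftrightarrow>
     (\<forall>x. AE \<omega> in stable_walk_space \<alpha>. \<exists>n. walk_pos x \<omega> n \<in> B)"

end

theory Submission
  imports Defs
begin

text \<open>Write \<open>\<beta> = \<alpha> / 2\<close>. Subordination gives the Green function as
  \<open>G(x) = \<Sum>\<^sub>k d\<^sub>k p\<^sub>k(x)\<close>, where \<open>p\<^sub>k\<close> is the law of \<open>k\<close> simple random walk steps and \<open>d\<^sub>k\<close> is the coefficient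
  of \<open>s\<^sup>k\<close> in the power series of \<open>1 / (1 - s)\<^sup>\<beta>\<close>. Summing the binomial recurrences of \<open>p\<^sub>k\<close> shows that
  \<open>(x + 1 - \<beta>) G(x + 1) - (x + \<beta>) G(x)\<close> is constant in \<open>x\<close>, and the constant is \<open>0\<close> because \<open>G\<close> vanishes at
  infinity. Hence \<open>G\<close> is an explicit Gamma quotient, comparable to \<open>\<bar>x\<bar>\<close> to the power \<open>\<alpha> - 1\<close>.

  If the series converges, the expected number of visits to the set from \<open>- N\<close> tends to \<open>0\<close> as
  \<open>N\<close> grows, so the set is not massive. If it diverges, let \<open>S\<close> be the \<open>m\<close>-th partial sum.
  By superlinearity, the expected number of visits to the first \<open>m\<close> points, started from any of
  these points, is at most \<open>G(0) + 2 C S\<close>; from an arbitrary \<open>x\<close> it is at least \<open>c' S - O(1)\<close>.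
  The quotient bounds the hitting probability from below, uniformly in \<open>x\<close>, and
  a uniform lower bound forces hitting probability \<open>1\<close> by the Markov property.\<close>

section \<open>Simple random walk probabilities and Pochhammer quotients\<close>

lemma srw_step_prob_0: "srw_step_prob 0 z = (if z = 0 then 1 else 0)"
  by (auto simp: srw_step_prob_def)

lemma srw_step_prob_nonneg: "0 \<le> srw_step_prob k z"
  by (simp add: srw_step_prob_def)

lemma srw_step_prob_minus: "srw_step_prob k (- z) = srw_step_prob k z"
proof (cases "\<bar>z\<bar> \<le> int k \<and> even (int k + z)")
  case True
  then obtain j where j: "int k + z = 2 * j" by (meson evenE)
  have "0 \<le> j" "(int k - z) div 2 = int k - j" "(int k + z) div 2 = j" "j \<le> int k"
    using j True by linarith+
  then have 1: "nat ((int k + z) div 2) \<le> k" "nat ((int k - z) div 2) = k - nat ((int k + z) div 2)"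
    by (metis nat_int nat_mono, metis nat_diff_distrib nat_int)
  have "k choose nat ((int k + - z) div 2) = k choose nat ((int k + z) div 2)"
    using binomial_symmetric[OF 1(1)] 1(2) by simp
  moreover have "\<bar>- z\<bar> \<le> int k \<and> even (int k + - z)" using True by simp
  ultimately show ?thesis
    using True unfolding srw_step_prob_def by (simp only: if_True)
next
  case False
  then have "\<not> (\<bar>-z\<bar> \<le> int k \<and> even (int k + - z))" by auto
  with False show ?thesis unfolding srw_step_prob_def by (simp only: if_False)
qed

lemma srw_step_prob_eq_0: "int k < \<bar>z\<bar> \<Longrightarrow> srw_step_prob k z = 0"
  by (simp add: srw_step_prob_def)

lemma srw_step_prob_Suc:
  "srw_step_prob (Suc k) z = (srw_step_prob k (z - 1) + srw_step_prob k (z + 1)) / 2"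
proof (cases "even (int k + z + 1)")
  case False
  then have "\<not> even (int (Suc k) + z)" "\<not> even (int k + (z - 1))" "\<not> even (int k + (z + 1))"
    by presburger+
  then show ?thesis by (simp add: srw_step_prob_def)
next
  case True
  \<comment> \<open>Extending the binomial coefficient by \<open>0\<close> to negative lower indices
    lets Pascal's rule cover the ends of the range.\<close>
  define B where "B = (\<lambda>k i. if i < 0 then 0 else real (k choose nat i))"
  have B: "srw_step_prob k z = B k ((int k + z) div 2) / 2 ^ k" if "even (int k + z)" for k z
  proof -
    from that obtain i where i: "int k + z = 2 * i" by (meson evenE)
    then have "\<bar>z\<bar> \<le> int k \<longleftrightarrow> 0 \<le> i \<and> i \<le> int k" by linarith
    with i that show ?thesis by (auto simp: srw_step_prob_def B_def binomial_eq_0)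
  qed
  obtain j where j: "int k + z + 1 = 2 * j" using True by (meson evenE)
  have e: "even (int (Suc k) + z)" "even (int k + (z - 1))" "even (int k + (z + 1))"
    "(int (Suc k) + z) div 2 = j" "(int k + (z - 1)) div 2 = j - 1" "(int k + (z + 1)) div 2 = j"
    using j by presburger+
  have "B (Suc k) j = B k (j - 1) + B k j"
  proof (cases "j \<le> 0")
    case True
    then show ?thesis by (cases "j = 0") (auto simp: B_def)
  next
    case False
    then obtain i where i: "j = int (Suc i)" by (metis not_le pos_int_cases Suc_pred)
    then have "j - 1 = int i" "\<not> j < 0" "nat j = Suc i" by simp_all
    then show ?thesis by (simp add: B_def)
  qed
  then show ?thesis
    unfolding B[OF e(1)] B[OF e(2)] B[OF e(3)] e(4-6) by (simp add: add_divide_distrib)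
qed

text \<open>For 2 i = k + x - 1 this is (i + 1) C(k, i + 1) = (k - i) C(k, i); otherwise both sides
  vanish. Induction on \<open>k\<close> avoids the distinction of parities.\<close>

lemma srw_step_prob_ratio:
  "(real k + 1 - of_int x) * srw_step_prob k (x - 1) = (real k + 1 + of_int x) * srw_step_prob k (x + 1)"
proof (induction k arbitrary: x)
  case 0
  show ?case by (auto simp: srw_step_prob_0)
next
  case (Suc k)
  have "(real k + 2 - of_int x) * srw_step_prob k (x - 2) = (real k + of_int x) * srw_step_prob k x"
    using Suc.IH[of "x - 1"] by (simp add: algebra_simps)
  moreover have "(real k - of_int x) * srw_step_prob k x = (real k + 2 + of_int x) * srw_step_prob k (x + 2)"
    using Suc.IH[of "x + 1"] by (simp add: algebra_simps)
  ultimately show ?case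
    by (simp add: srw_step_prob_Suc field_simps)
qed

lemma srw_step_prob_double_0:
  "srw_step_prob (2 * Suc m) 0 = srw_step_prob (2 * m) 0 * ((2 * real m + 1) / (2 * real m + 2))"
proof -
  have "2 * real m * srw_step_prob (2 * m) 0 = (2 * real m + 2) * srw_step_prob (2 * m) 2"
    using srw_step_prob_ratio[of "2*m" 1] by simp
  moreover have "srw_step_prob (2 * m) (-2) = srw_step_prob (2 * m) 2"
    using srw_step_prob_minus[of "2*m" 2] by simp
  ultimately show ?thesis
    by (simp add: srw_step_prob_Suc field_simps)
qed

text \<open>Passing from \<open>m\<close> to \<open>Suc m\<close> multiplies the left side by (2m +
  1)(2m + 3) / (2m + 2)^2, which is less than 1.\<close>

lemma srw_step_prob_double_0_le: "(srw_step_prob (2 * m) 0)\<^sup>2 * (2 * real m + 1) \<le> 1"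
proof (induction m)
  case 0
  show ?case by (simp add: srw_step_prob_0)
next
  case (Suc m)
  let ?q = "srw_step_prob (2 * m) 0"
  have "(srw_step_prob (2 * Suc m) 0)\<^sup>2 * (2 * real (Suc m) + 1)
      = ?q\<^sup>2 * (2 * real m + 1) * ((2 * real m + 1) * (2 * real m + 3) / (2 * real m + 2)\<^sup>2)"
    unfolding srw_step_prob_double_0 by (simp add: power_mult_distrib power_divide power2_eq_square)
  also have "\<dots> \<le> 1 * 1"
    by (intro mult_mono Suc, subst divide_le_eq_1_pos) (simp_all add: power2_eq_square algebra_simps add_pos_nonneg)
  finally show ?case by simp
qed

lemma srw_step_prob_even_le: "srw_step_prob (2 * m) x \<le> srw_step_prob (2 * m) 0"
  using binomial_maximum[of "2*m" "nat ((int (2*m) + x) div 2)"]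
  by (auto simp: srw_step_prob_def divide_right_mono)

text \<open>Put k = 2m or k = 2m + 1. An odd-time probability averages two probabilities at time 2m,
  each at most the central one, and \<open>k \<le> 2 * m + 1\<close> in both cases.\<close>

lemma srw_step_prob_le:
  assumes "k > 0"
  shows "srw_step_prob k x \<le> real k powr (- (1/2))"
proof -
  have *: "q \<le> real k powr (- (1/2))" if "0 \<le> q" "q\<^sup>2 * (2 * real m + 1) \<le> 1" "k \<le> 2 * m + 1" for q m
  proof -
    have "q\<^sup>2 * real k \<le> q\<^sup>2 * (2 * real m + 1)"
      using that(3) by (intro mult_left_mono) auto
    with that(2) have "q\<^sup>2 \<le> 1 / real k" using assms by (simp add: field_simps)
    then have "q \<le> sqrt (1 / real k)" by (rule real_le_rsqrt)
    also have "\<dots> = real k powr (- (1/2))"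
      unfolding powr_minus by (simp add: real_sqrt_divide powr_half_sqrt inverse_eq_divide)
    finally show ?thesis .
  qed
  obtain m where m: "k = 2 * m \<or> k = Suc (2 * m)" by (metis oddE evenE Suc_eq_plus1)
  then have "srw_step_prob (2*m) 0 \<le> real k powr (- (1/2))"
    using * srw_step_prob_nonneg srw_step_prob_double_0_le by (metis Suc_eq_plus1 le_add1 order_refl)
  moreover have "srw_step_prob k x \<le> srw_step_prob (2*m) 0"
    using m srw_step_prob_even_le[of m x] srw_step_prob_even_le[of m "x-1"] srw_step_prob_even_le[of m "x+1"]
    by (elim disjE) (simp_all add: srw_step_prob_Suc)
  ultimately show ?thesis by linarith
qed

section \<open>Power asymptotics of Pochhammer quotients\<close>

text \<open>Quotient of Euler's product limits for \<open>Gamma b\<close> and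
  \<open>Gamma a\<close>; the factorials cancel.\<close>

lemma pochhammer_quotient_LIMSEQ:
  fixes a b :: real
  assumes "0 < a" "0 < b"
  shows "(\<lambda>n. pochhammer a n / pochhammer b n * real n powr (b - a)) \<longlonglongrightarrow> Gamma b / Gamma a"
proof -
  have "(\<lambda>n. Gamma_series' b n / Gamma_series' a n) \<longlonglongrightarrow> Gamma b / Gamma a"
    using assms by (intro tendsto_divide Gamma_series'_LIMSEQ) (auto simp: Gamma_eq_zero_iff dest: nonpos_Ints_nonpos)
  moreover have "\<forall>\<^sub>F n in sequentially. Gamma_series' b n / Gamma_series' a n
      = pochhammer a n / pochhammer b n * real n powr (b - a)"
    using eventually_gt_at_top[of 0]
    by eventually_elim (simp add: Gamma_series'_def powr_def exp_diff left_diff_distrib divide_simps)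
  ultimately show ?thesis by (rule Lim_transform_eventually)
qed

text \<open>The normalised quotient has a nonzero limit, so it and its reciprocal are bounded. Index
  \<open>0\<close> is excluded because \<open>0 powr r = 0\<close> would break the upper
  bound.\<close>

lemma pochhammer_quotient_bounds:
  fixes a b :: real
  assumes "0 < a" "0 < b"
  obtains c C where "0 < c" "0 < C"
    "\<And>n. n > 0 \<Longrightarrow> c * real n powr (a - b) \<le> pochhammer a n / pochhammer b n"
    "\<And>n. n > 0 \<Longrightarrow> pochhammer a n / pochhammer b n \<le> C * real n powr (a - b)"
proof -
  define f where "f n = pochhammer a n / pochhammer b n * real n powr (b - a)" for n
  have f: "f \<longlonglongrightarrow> Gamma b / Gamma a"
    unfolding f_def by (rule pochhammer_quotient_LIMSEQ[OF assms])
  have pos: "f n > 0" if "n > 0" for n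
    using that assms by (simp add: f_def pochhammer_pos)
  have fe: "pochhammer a n / pochhammer b n = f n * real n powr (a - b)" if "n > 0" for n
    using that by (simp add: f_def powr_diff)
  have "Bseq f" using f by (intro convergent_imp_Bseq) (auto simp: convergent_def)
  then obtain C where C: "C > 0" "\<And>n. norm (f n) \<le> C" by (auto elim: BseqE)
  have "Gamma b / Gamma a \<noteq> 0"
    using assms by (auto simp: Gamma_eq_zero_iff dest: nonpos_Ints_nonpos)
  with f have "(\<lambda>n. inverse (f n)) \<longlonglongrightarrow> inverse (Gamma b / Gamma a)"
    by (rule tendsto_inverse)
  then have "Bseq (\<lambda>n. inverse (f n))"
    by (intro convergent_imp_Bseq) (auto simp: convergent_def)
  then obtain c where c: "c > 0" "\<And>n. norm (inverse (f n)) \<le> c" by (auto elim: BseqE)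
  show ?thesis
  proof (rule that[of "1 / c" C])
    fix n :: nat assume n: "n > 0"
    have "1 / c \<le> f n" using c(1) c(2)[of n] pos[OF n] by (simp add: field_simps)
    then show "1 / c * real n powr (a - b) \<le> pochhammer a n / pochhammer b n"
      unfolding fe[OF n] by (intro mult_right_mono) auto
    show "pochhammer a n / pochhammer b n \<le> C * real n powr (a - b)"
      unfolding fe[OF n] using C(2)[of n] by (intro mult_right_mono) auto
  qed (use c C in auto)
qed

lemma pochhammer_quotient_tendsto_0:
  fixes a b :: real
  assumes "0 < a" "a < b"
  shows "(\<lambda>n. pochhammer a n / pochhammer b n) \<longlonglongrightarrow> 0"
proof -
  have "0 < b" using assms by simp
  with assms(1) obtain c C where C: "0 < c" "0 < C"
    "\<And>n. n > 0 \<Longrightarrow> c * real n powr (a - b) \<le> pochhammer a n / pochhammer b n"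
    "\<And>n. n > 0 \<Longrightarrow> pochhammer a n / pochhammer b n \<le> C * real n powr (a - b)"
    by (rule pochhammer_quotient_bounds) (rule that)
  have "(\<lambda>n. C * real n powr (a - b)) \<longlonglongrightarrow> C * 0"
    using assms by (intro tendsto_mult tendsto_const tendsto_neg_powr filterlim_real_sequentially) auto
  moreover have "\<forall>\<^sub>F n in sequentially. 0 \<le> pochhammer a n / pochhammer b n"
    using assms by (intro always_eventually allI divide_nonneg_nonneg pochhammer_nonneg) auto
  moreover have "\<forall>\<^sub>F n in sequentially. pochhammer a n / pochhammer b n \<le> C * real n powr (a - b)"
    using eventually_gt_at_top[of 0] by eventually_elim (rule C(4))
  ultimately show ?thesis
    using tendsto_sandwich[of "\<lambda>_. 0" "\<lambda>n. pochhammer a n / pochhammer b n" _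
      "\<lambda>n. C * real n powr (a - b)" 0] by simp
qed

section \<open>The Green function\<close>

text \<open>The coefficient of s^k in (1 - s)^(-\<beta>); \<open>subordinator_visits\<close>
  identifies it with the expected number of visits of the subordinator to \<open>k\<close>.\<close>

definition subordinator_green :: "real \<Rightarrow> nat \<Rightarrow> real" where
  "subordinator_green \<beta> k = pochhammer \<beta> k / fact k"

definition stable_green :: "real \<Rightarrow> int \<Rightarrow> real" where
  "stable_green \<beta> x = (\<Sum>k. subordinator_green \<beta> k * srw_step_prob k x)"

lemma subordinator_green_pos: "0 < \<beta> \<Longrightarrow> 0 < subordinator_green \<beta> k"
  by (simp add: subordinator_green_def pochhammer_pos)

lemma subordinator_green_Suc:
  "(real k + 1) * subordinator_green \<beta> (Suc k) = (real k + \<beta>) * subordinator_green \<beta> k"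
  by (simp add: subordinator_green_def pochhammer_Suc divide_simps) (simp add: algebra_simps)

text \<open>The factors are of order at most k^(\<beta> - 1) and k^(-1/2), and k^(\<beta> - 3/2) is
  summable because \<beta> < 1/2. The bound is uniform in \<open>x\<close>, as the limit at infinity
  requires.\<close>

lemma green_summand_dominated:
  assumes "0 < \<beta>" "\<beta> < 1/2"
  obtains f where "summable f"
    "\<And>k x. subordinator_green \<beta> k * srw_step_prob k x \<le> f k"
proof -
  obtain c C where c: "0 < c" and C: "0 < C"
    and "\<And>n. n > 0 \<Longrightarrow> c * real n powr (\<beta> - 1) \<le> pochhammer \<beta> n / pochhammer 1 n"
    and C_le: "\<And>n. n > 0 \<Longrightarrow> pochhammer \<beta> n / pochhammer 1 n \<le> C * real n powr (\<beta> - 1)"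
    by (rule pochhammer_quotient_bounds[OF assms(1) zero_less_one]) (rule that)
  define f where "f k = (if k = 0 then 1 else C * real k powr (\<beta> - 3/2))" for k
  have "summable (\<lambda>k. C * real k powr (\<beta> - 3/2))"
    using assms by (intro summable_mult) (simp add: summable_real_powr_iff)
  then have "summable f"
    by (rule summable_cong[THEN iffD1, rotated]) (auto simp: f_def eventually_sequentially intro!: exI[of _ 1])
  moreover have "subordinator_green \<beta> k * srw_step_prob k x \<le> f k" for k x
  proof (cases "k = 0")
    case True
    then show ?thesis by (simp add: f_def subordinator_green_def srw_step_prob_0)
  next
    case False
    then have "subordinator_green \<beta> k * srw_step_prob k x \<le> (C * real k powr (\<beta> - 1)) * real k powr (- (1/2))"
      using C C_le[of k] assms by (intro mult_mono srw_step_prob_le srw_step_prob_nonneg)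
        (auto simp: subordinator_green_def pochhammer_fact)
    also have "\<dots> = f k" using False by (simp add: f_def flip: powr_add)
    finally show ?thesis .
  qed
  ultimately show ?thesis by (rule that)
qed

context
  fixes \<beta> :: real
  assumes \<beta>: "0 < \<beta>" "\<beta> < 1/2"
begin

lemma green_summand_nonneg: "0 \<le> subordinator_green \<beta> k * srw_step_prob k x"
  using subordinator_green_pos[of \<beta> k] \<beta> srw_step_prob_nonneg[of k x] by simp

lemma stable_green_summable: "summable (\<lambda>k. subordinator_green \<beta> k * srw_step_prob k x)"
proof -
  obtain f where "summable f" "\<And>k x. subordinator_green \<beta> k * srw_step_prob k x \<le> f k"
    using green_summand_dominated \<beta> by blast
  then show ?thesis using green_summand_nonneg
    by (auto intro!: summable_comparison_test'[of f 0])
qed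

lemma stable_green_sums: "(\<lambda>k. subordinator_green \<beta> k * srw_step_prob k x) sums stable_green \<beta> x"
  unfolding stable_green_def using stable_green_summable by (rule summable_sums)

lemma stable_green_minus: "stable_green \<beta> (- x) = stable_green \<beta> x"
  by (simp add: stable_green_def srw_step_prob_minus)

lemma stable_green_nonneg: "0 \<le> stable_green \<beta> x"
  unfolding stable_green_def by (intro suminf_nonneg stable_green_summable green_summand_nonneg)

lemma stable_green_0_pos: "0 < stable_green \<beta> 0"
  unfolding stable_green_def
proof (rule suminf_pos2[where i = 0])
  show "0 < subordinator_green \<beta> 0 * srw_step_prob 0 0"
    by (simp add: subordinator_green_def srw_step_prob_0)
qed (use stable_green_summable green_summand_nonneg in auto)

text \<open>Before time \<open>n\<close> the simple random walk cannot reach \<open>n\<close>, so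
  only a tail of the dominating series remains.\<close>

lemma stable_green_tendsto_0: "(\<lambda>n. stable_green \<beta> (int n)) \<longlonglongrightarrow> 0"
proof -
  obtain f where f: "summable f" "\<And>k x. subordinator_green \<beta> k * srw_step_prob k x \<le> f k"
    using green_summand_dominated \<beta> by blast
  have "stable_green \<beta> (int n) \<le> suminf f - (\<Sum>k<n. f k)" for n
  proof -
    let ?g = "\<lambda>k. subordinator_green \<beta> k * srw_step_prob k (int n)"
    have "stable_green \<beta> (int n) = (\<Sum>k. ?g (k + n)) + (\<Sum>k<n. ?g k)"
      unfolding stable_green_def by (rule suminf_split_initial_segment[OF stable_green_summable])
    also have "(\<Sum>k<n. ?g k) = 0"
      by (intro sum.neutral) (auto simp: srw_step_prob_eq_0)
    also have "(\<Sum>k. ?g (k + n)) \<le> (\<Sum>k. f (k + n))"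
      using f stable_green_summable[THEN summable_ignore_initial_segment]
      by (intro suminf_le) (auto intro: summable_ignore_initial_segment)
    also have "\<dots> = suminf f - (\<Sum>k<n. f k)"
      by (rule suminf_minus_initial_segment[OF f(1)])
    finally show ?thesis by simp
  qed
  moreover have "(\<lambda>n. suminf f - (\<Sum>k<n. f k)) \<longlonglongrightarrow> suminf f - suminf f"
    by (intro tendsto_intros summable_LIMSEQ f)
  ultimately show ?thesis
    using stable_green_nonneg tendsto_sandwich[of "\<lambda>_. 0" "\<lambda>n. stable_green \<beta> (int n)" sequentially
      "\<lambda>n. suminf f - (\<Sum>k<n. f k)" 0]
    by (simp add: always_eventually)
qed

section \<open>Recurrence and closed form of the Green function\<close>

text \<open>Write \<open>d\<^sub>k\<close> and \<open>p\<^sub>k\<close> for \<open>subordinator_green \<beta> k\<close> and \<open>srw_step_prob k\<close>. The right-hand side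
  minus the left-hand side is a sum over \<open>k\<close> that telescopes: its terms are the increments of
  \<open>2 x d\<^sub>k p\<^sub>k(x)\<close>, which vanishes at \<open>k = 0\<close> and tends to \<open>0\<close>.\<close>
lemma stable_green_second_order:
  "2 * of_int x * stable_green \<beta> x
     = (of_int x - 1 + \<beta>) * stable_green \<beta> (x - 1) + (of_int x + 1 - \<beta>) * stable_green \<beta> (x + 1)"
proof -
  let ?d = "subordinator_green \<beta>" and ?p = "srw_step_prob"
  define U where "U k = 2 * of_int x * (?d k * ?p k x)" for k
  have "U \<longlonglongrightarrow> 2 * of_int x * 0"
    unfolding U_def by (intro tendsto_mult tendsto_const summable_LIMSEQ_zero stable_green_summable)
  then have "(\<lambda>k. U (Suc k) - U k) sums (0 - U 0)"
    using telescope_sums by fastforce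
  moreover have "U 0 = 0" by (simp add: U_def srw_step_prob_0)
  moreover have "U (Suc k) - U k = (of_int x - 1 + \<beta>) * (?d k * ?p k (x - 1))
      + (of_int x + 1 - \<beta>) * (?d k * ?p k (x + 1)) - 2 * of_int x * (?d k * ?p k x)" for k
  proof -
    \<comment> \<open>The ratio identity trades the factor \<open>x\<close> for
      \<open>k + 1\<close>, the factor on which the recurrence of \<open>subordinator_green\<close>
      acts.\<close>
    have r: "of_int x * (?p k (x - 1) + ?p k (x + 1)) = (real k + 1) * (?p k (x - 1) - ?p k (x + 1))"
      using srw_step_prob_ratio[of k x] by (simp add: algebra_simps)
    have "U (Suc k) = ?d (Suc k) * (of_int x * (?p k (x - 1) + ?p k (x + 1)))"
      by (simp add: U_def srw_step_prob_Suc)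
    also have "\<dots> = (real k + 1) * ?d (Suc k) * (?p k (x - 1) - ?p k (x + 1))"
      unfolding r by simp
    also have "\<dots> = (real k + \<beta>) * ?d k * (?p k (x - 1) - ?p k (x + 1))"
      unfolding subordinator_green_Suc ..
    also have "\<dots> = ?d k * (of_int x * (?p k (x - 1) + ?p k (x + 1)) - (1 - \<beta>) * (?p k (x - 1) - ?p k (x + 1)))"
      unfolding r by (simp add: algebra_simps)
    finally show ?thesis by (simp add: U_def algebra_simps)
  qed
  ultimately have "(\<lambda>k. (of_int x - 1 + \<beta>) * (?d k * ?p k (x - 1))
      + (of_int x + 1 - \<beta>) * (?d k * ?p k (x + 1)) - 2 * of_int x * (?d k * ?p k x)) sums 0"
    by simp
  moreover have "(\<lambda>k. (of_int x - 1 + \<beta>) * (?d k * ?p k (x - 1))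
      + (of_int x + 1 - \<beta>) * (?d k * ?p k (x + 1)) - 2 * of_int x * (?d k * ?p k x)) sums
     ((of_int x - 1 + \<beta>) * stable_green \<beta> (x - 1) + (of_int x + 1 - \<beta>) * stable_green \<beta> (x + 1)
      - 2 * of_int x * stable_green \<beta> x)"
    by (intro sums_add sums_diff sums_mult stable_green_sums)
  ultimately show ?thesis using sums_unique2 by fastforce
qed

text \<open>A solution of the first-order recurrence is a constant plus a multiple of the Pochhammer
  quotient; since the Green function and the quotient both tend to \<open>0\<close>, the constant is
  \<open>0\<close>.\<close>

lemma stable_green_of_nat:
  "stable_green \<beta> (int n) = stable_green \<beta> 0 * (pochhammer \<beta> n / pochhammer (1 - \<beta>) n)"
proof -
  let ?G = "\<lambda>n. stable_green \<beta> (int n)" and ?w = "\<lambda>n. pochhammer \<beta> n / pochhammer (1 - \<beta>) n"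
  \<comment> \<open>the second-order recurrence says that this first-order expression does not depend on \<open>n\<close>\<close>
  define D where "D = (1 - \<beta>) * ?G 1 - \<beta> * ?G 0"
  have D: "(real n + 1 - \<beta>) * ?G (Suc n) - (real n + \<beta>) * ?G n = D" for n
  proof (induction n)
    case (Suc n)
    then show ?case using stable_green_second_order[of "int (Suc n)"] by (simp add: algebra_simps)
  qed (simp add: D_def)
  \<comment> \<open>The constant solution: (n + 1 - \<beta>) e - (n + \<beta>) e = (1 - 2 \<beta>)
    e.\<close>
  define e where "e = D / (1 - 2 * \<beta>)"
  have De: "D = (1 - 2 * \<beta>) * e" using \<beta> by (simp add: e_def)
  have G: "?G n = e + (?G 0 - e) * ?w n" for n
  proof (induction n)
    case (Suc n)
    have nz: "real n + 1 - \<beta> \<noteq> 0" "pochhammer (1 - \<beta>) n \<noteq> 0"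
      using \<beta> pochhammer_pos[of "1 - \<beta>" n] by auto
    have w: "(real n + 1 - \<beta>) * ?w (Suc n) = (real n + \<beta>) * ?w n"
      using nz by (simp add: pochhammer_Suc divide_simps) (simp add: algebra_simps)
    have "(real n + 1 - \<beta>) * ?G (Suc n) = D + (real n + \<beta>) * ?G n"
      using D[of n] by simp
    also have "\<dots> = (real n + 1 - \<beta>) * e + (?G 0 - e) * ((real n + \<beta>) * ?w n)"
      unfolding Suc De by (simp add: algebra_simps)
    also have "\<dots> = (real n + 1 - \<beta>) * (e + (?G 0 - e) * ?w (Suc n))"
      unfolding w[symmetric] by (simp add: algebra_simps)
    finally show ?case using nz by simp
  qed simp
  have "?w \<longlonglongrightarrow> 0"
    using \<beta> by (intro pochhammer_quotient_tendsto_0) auto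
  then have "(\<lambda>n. e + (?G 0 - e) * ?w n) \<longlonglongrightarrow> e + (?G 0 - e) * 0"
    by (intro tendsto_intros)
  then have "?G \<longlonglongrightarrow> e" unfolding G[symmetric] by simp
  with stable_green_tendsto_0 have "e = 0" by (rule LIMSEQ_unique[symmetric])
  with G show ?thesis by simp
qed

lemma stable_green_bounds:
  obtains c C where "0 < c" "0 < C"
    "\<And>x. x \<noteq> 0 \<Longrightarrow> c * real_of_int \<bar>x\<bar> powr (2 * \<beta> - 1) \<le> stable_green \<beta> x"
    "\<And>x. x \<noteq> 0 \<Longrightarrow> stable_green \<beta> x \<le> C * real_of_int \<bar>x\<bar> powr (2 * \<beta> - 1)"
proof -
  let ?w = "\<lambda>n. pochhammer \<beta> n / pochhammer (1 - \<beta>) n"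
  have "0 < 1 - \<beta>" using \<beta> by simp
  then obtain c C where C: "0 < c" "0 < C" "\<And>n. n > 0 \<Longrightarrow> c * real n powr (\<beta> - (1 - \<beta>)) \<le> ?w n"
    "\<And>n. n > 0 \<Longrightarrow> ?w n \<le> C * real n powr (\<beta> - (1 - \<beta>))"
    by (rule pochhammer_quotient_bounds[OF \<beta>(1)]) (rule that)
  have e: "\<beta> - (1 - \<beta>) = 2 * \<beta> - 1" by simp
  have G: "stable_green \<beta> x = stable_green \<beta> 0 * ?w (nat \<bar>x\<bar>)" for x
    using stable_green_of_nat[of "nat \<bar>x\<bar>"] stable_green_minus[of x] by (cases "x \<ge> 0") auto
  show ?thesis
  proof (rule that[of "stable_green \<beta> 0 * c" "stable_green \<beta> 0 * C"])
    fix x :: int assume "x \<noteq> 0"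
    then have x: "nat \<bar>x\<bar> > 0" "real (nat \<bar>x\<bar>) = real_of_int \<bar>x\<bar>" by auto
    show "stable_green \<beta> 0 * c * real_of_int \<bar>x\<bar> powr (2 * \<beta> - 1) \<le> stable_green \<beta> x"
      unfolding G[of x] mult.assoc using C(3)[OF x(1)] stable_green_0_pos unfolding x(2) e
      by (intro mult_left_mono) auto
    show "stable_green \<beta> x \<le> stable_green \<beta> 0 * C * real_of_int \<bar>x\<bar> powr (2 * \<beta> - 1)"
      unfolding G[of x] mult.assoc using C(4)[OF x(1)] stable_green_0_pos unfolding x(2) e
      by (intro mult_left_mono) auto
  qed (use C stable_green_0_pos in auto)
qed

end

section \<open>Subordination\<close>

text \<open>Monoids cover both the subordinator on \<open>nat\<close> and the walks on
  \<open>int\<close>.\<close>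

primrec convolution_power :: "'a::monoid_add pmf \<Rightarrow> nat \<Rightarrow> 'a pmf" where
  "convolution_power p 0 = return_pmf 0"
| "convolution_power p (Suc n) = bind_pmf p (\<lambda>x. map_pmf ((+) x) (convolution_power p n))"

lemma convolution_power_add:
  "convolution_power p (m + n)
     = bind_pmf (convolution_power p m) (\<lambda>x. map_pmf ((+) x) (convolution_power p n))"
proof (induction m)
  case 0
  have "(+) (0 :: 'a) = (\<lambda>x. x)" by auto
  then show ?case by (simp add: bind_return_pmf)
next
  case (Suc m)
  have "(+) (x + y) = (\<lambda>z. x + (y + z))" for x y :: 'a
    by (simp add: fun_eq_iff add.assoc)
  with Suc show ?case
    by (simp add: bind_assoc_pmf map_bind_pmf bind_map_pmf pmf.map_comp o_def)
qed

text \<open>The identity in law between S_\<alpha>(n) and S(\<tau>_n): the time increments commute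
  past the independent walk increments, and walks of \<open>k\<close> and \<open>l\<close> steps
  glue to one of \<open>k + l\<close> steps.\<close>

lemma convolution_power_subordination:
  "convolution_power (bind_pmf T (convolution_power s)) n
     = bind_pmf (convolution_power T n) (convolution_power s)"
proof (induction n)
  case 0
  show ?case by (simp add: bind_return_pmf)
next
  case (Suc n)
  have "convolution_power (bind_pmf T (convolution_power s)) (Suc n)
      = bind_pmf T (\<lambda>k. bind_pmf (convolution_power s k) (\<lambda>x.
          bind_pmf (convolution_power T n) (\<lambda>l. map_pmf ((+) x) (convolution_power s l))))"
    by (simp add: Suc bind_assoc_pmf map_bind_pmf)
  also have "\<dots> = bind_pmf T (\<lambda>k. bind_pmf (convolution_power T n) (\<lambda>l. convolution_power s (k + l)))"
    by (subst bind_commute_pmf) (simp add: convolution_power_add)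
  also have "\<dots> = bind_pmf (convolution_power T (Suc n)) (convolution_power s)"
    by (simp add: bind_assoc_pmf bind_map_pmf)
  finally show ?case .
qed

lemma pmf_translate:
  fixes x :: "'a::group_add"
  shows "pmf (map_pmf ((+) x) p) y = pmf p (- x + y)"
proof -
  have "pmf (map_pmf ((+) x) p) (x + (- x + y)) = pmf p (- x + y)"
    by (rule pmf_map_inj') (simp add: inj_def)
  then show ?thesis by (simp add: add.assoc[symmetric])
qed

lemma pmf_convolution_power_Suc:
  fixes p :: "'a::group_add pmf"
  shows "ennreal (pmf (convolution_power p (Suc n)) y) = (\<integral>\<^sup>+x. pmf (convolution_power p n) (- x + y) \<partial>p)"
  by (simp add: ennreal_pmf_bind pmf_translate)

definition srw_step :: "int pmf" where
  "srw_step = pmf_of_set {-1, 1}"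

lemma pmf_srw: "pmf (convolution_power srw_step k) z = srw_step_prob k z"
proof (induction k arbitrary: z)
  case 0
  show ?case by (simp add: srw_step_prob_0 pmf_return)
next
  case (Suc k)
  have "ennreal (pmf (convolution_power srw_step (Suc k)) z) = ennreal (srw_step_prob (Suc k) z)"
    unfolding pmf_convolution_power_Suc srw_step_def
    by (subst nn_integral_pmf_of_set)
      (simp_all add: Suc[unfolded srw_step_def] srw_step_prob_Suc srw_step_prob_nonneg add.commute
        flip: ennreal_plus ennreal_numeral divide_ennreal)
  then show ?case
    by (simp add: srw_step_prob_nonneg)
qed

section \<open>The discrete stable subordinator and expected numbers of visits\<close>

text \<open>The value at \<open>0\<close> is set separately because
  \<open>stable_coeff \<alpha> 0\<close> is -1.\<close>

definition subordinator_incr :: "real \<Rightarrow> nat pmf" where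
  "subordinator_incr \<alpha> = embed_pmf (\<lambda>k. if k = 0 then 0 else stable_coeff \<alpha> k)"

lemma stable_coeff_pochhammer: "stable_coeff \<alpha> k = - pochhammer (- (\<alpha> / 2)) k / fact k"
  by (simp add: stable_coeff_def gbinomial_pochhammer flip: power_mult_distrib mult.assoc)

lemma stable_coeff_nonneg:
  assumes "0 < \<alpha>" "\<alpha> < 2" "k > 0"
  shows "0 \<le> stable_coeff \<alpha> k"
proof -
  obtain n where "k = Suc n" using assms(3) gr0_implies_Suc by blast
  moreover have "0 < pochhammer (- (\<alpha> / 2) + 1) n"
    using assms by (intro pochhammer_pos) simp
  ultimately show ?thesis
    using assms by (simp add: stable_coeff_pochhammer pochhammer_rec)
qed

text \<open>Each coefficient is a difference of consecutive quotients (1 - \<beta>)_n / n!, so the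
  partial sums telescope and the remainder tends to \<open>0\<close>.\<close>

lemma stable_coeff_sums:
  assumes "0 < \<alpha>" "\<alpha> < 2"
  shows "(\<lambda>k. if k = 0 then 0 else stable_coeff \<alpha> k) sums 1"
proof -
  define \<beta> where "\<beta> = \<alpha> / 2"
  have \<beta>: "0 < \<beta>" "0 < 1 - \<beta>" using assms by (auto simp: \<beta>_def)
  have partial: "(\<Sum>k\<le>n. if k = 0 then 0 else stable_coeff \<alpha> k) = 1 - pochhammer (1 - \<beta>) n / pochhammer 1 n" for n
  proof (induction n)
    case (Suc n)
    have "stable_coeff \<alpha> (Suc n) = \<beta> * pochhammer (1 - \<beta>) n / fact (Suc n)"
      by (simp add: stable_coeff_pochhammer pochhammer_rec \<beta>_def)
    also have "\<dots> = pochhammer (1 - \<beta>) n / pochhammer 1 n - pochhammer (1 - \<beta>) (Suc n) / pochhammer 1 (Suc n)"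
      by (simp add: pochhammer_fact[symmetric] pochhammer_Suc[of "1 - \<beta>"] divide_simps) (simp add: algebra_simps)
    finally show ?case using Suc by simp
  qed simp
  have "(\<lambda>n. pochhammer (1 - \<beta>) n / pochhammer 1 n) \<longlonglongrightarrow> 0"
    using \<beta> by (intro pochhammer_quotient_tendsto_0) auto
  then have "(\<lambda>n. 1 - pochhammer (1 - \<beta>) n / pochhammer 1 n) \<longlonglongrightarrow> 1 - 0"
    by (intro tendsto_intros)
  then show ?thesis unfolding sums_def_le partial by simp
qed

context
  fixes \<alpha> :: real
  assumes \<alpha>: "0 < \<alpha>" "\<alpha> < 2"
begin

lemma pmf_subordinator_incr: "pmf (subordinator_incr \<alpha>) k = (if k = 0 then 0 else stable_coeff \<alpha> k)"
  unfolding subordinator_incr_def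
proof (rule pmf_embed_pmf)
  show nn: "0 \<le> (if k = 0 then 0 else stable_coeff \<alpha> k)" for k
    using stable_coeff_nonneg[OF \<alpha>, of k] by auto
  show "(\<integral>\<^sup>+k. ennreal (if k = 0 then 0 else stable_coeff \<alpha> k) \<partial>count_space UNIV) = 1"
    unfolding nn_integral_count_space_nat
    by (subst suminf_ennreal2[OF nn]) (use stable_coeff_sums[OF \<alpha>] in \<open>auto simp: sums_iff\<close>)
qed

text \<open>Conditioning on the time gives the series of \<open>stable_step_prob\<close>, started at
  1 because time 0 has no mass. This also shows that \<open>stable_step_prob \<alpha>\<close> is a
  mass function, so that \<open>embed_pmf\<close> yields the intended law.\<close>

lemma stable_incr_eq: "stable_incr \<alpha> = bind_pmf (subordinator_incr \<alpha>) (convolution_power srw_step)"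
proof -
  have "stable_step_prob \<alpha> z = pmf (bind_pmf (subordinator_incr \<alpha>) (convolution_power srw_step)) z" for z
  proof -
    let ?f = "\<lambda>k. pmf (subordinator_incr \<alpha>) k * srw_step_prob k z"
    have "ennreal (pmf (bind_pmf (subordinator_incr \<alpha>) (convolution_power srw_step)) z) = (\<Sum>k. ennreal (?f k))"
      by (simp add: ennreal_pmf_bind pmf_srw nn_integral_measure_pmf nn_integral_count_space_nat ennreal_mult srw_step_prob_nonneg)
    then have "?f sums pmf (bind_pmf (subordinator_incr \<alpha>) (convolution_power srw_step)) z"
      by (intro sums_ennreal[THEN iffD1]) (auto simp: srw_step_prob_nonneg sums_iff)
    then have "(\<lambda>k. ?f (Suc k)) sums pmf (bind_pmf (subordinator_incr \<alpha>) (convolution_power srw_step)) z"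
      by (subst sums_Suc_iff) (simp add: pmf_subordinator_incr)
    then show ?thesis
      by (simp add: stable_step_prob_def pmf_subordinator_incr sums_iff)
  qed
  then have "stable_step_prob \<alpha> = pmf (bind_pmf (subordinator_incr \<alpha>) (convolution_power srw_step))" ..
  then show ?thesis
    unfolding stable_incr_def by (simp add: type_definition.Rep_inverse[OF td_pmf_embed_pmf])
qed

text \<open>The Vandermonde form of \<open>(1 - s)\<^sup>\<beta> (1 - s)\<^sup>-\<^sup>\<beta> = 1\<close> with \<open>\<beta> = \<alpha> / 2\<close>.\<close>
lemma subordinator_green_renewal:
  "subordinator_green (\<alpha> / 2) k = (if k = 0 then 1 else 0)
     + (\<Sum>i\<le>k. pmf (subordinator_incr \<alpha>) i * subordinator_green (\<alpha> / 2) (k - i))"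
proof -
  let ?g = "subordinator_green (\<alpha> / 2)"
  have "(if k = 0 then 1 else 0) = (- 1) ^ k * ((\<alpha>/2) + (- (\<alpha>/2)) gchoose k)"
    by (cases k) auto
  also have "\<dots> = (\<Sum>i\<le>k. (- 1) ^ k * (((\<alpha>/2) gchoose i) * ((- (\<alpha>/2)) gchoose (k - i))))"
    by (simp only: sum_distrib_left atLeast0AtMost flip: gbinomial_Vandermonde)
  also have "\<dots> = (\<Sum>i\<le>k. - stable_coeff \<alpha> i * ?g (k - i))"
  proof (intro sum.cong refl)
    fix i assume "i \<in> {..k}"
    then have "(- 1 :: real) ^ k = (- 1) ^ i * (- 1) ^ (k - i)"
      by (simp flip: power_add)
    then show "(- 1) ^ k * (((\<alpha>/2) gchoose i) * ((- (\<alpha>/2)) gchoose (k - i))) = - stable_coeff \<alpha> i * ?g (k - i)"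
      by (simp add: stable_coeff_def subordinator_green_def gbinomial_pochhammer[of "- (\<alpha>/2)"] flip: power_mult_distrib)
  qed
  also have "\<dots> = (\<Sum>i\<le>k. (if i = 0 then ?g k else 0) - pmf (subordinator_incr \<alpha>) i * ?g (k - i))"
    by (intro sum.cong) (auto simp: pmf_subordinator_incr stable_coeff_def)
  also have "\<dots> = ?g k - (\<Sum>i\<le>k. pmf (subordinator_incr \<alpha>) i * ?g (k - i))"
    by (simp add: sum_subtractf sum.delta)
  finally show ?thesis by simp
qed

text \<open>On \<open>nat\<close> there are no inverses for \<open>pmf_translate\<close>; instead a
  shift by \<open>i\<close> has no mass below \<open>i\<close>, which makes the convolution a finite
  sum.\<close>

lemma pmf_subordinator_Suc:
  "pmf (convolution_power (subordinator_incr \<alpha>) (Suc n)) k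
     = (\<Sum>i\<le>k. pmf (subordinator_incr \<alpha>) i * pmf (convolution_power (subordinator_incr \<alpha>) n) (k - i))"
proof -
  let ?T = "subordinator_incr \<alpha>"
  have *: "pmf (map_pmf ((+) i) p) k = (if i \<le> k then pmf p (k - i) else 0)" for i and p :: "nat pmf"
  proof (cases "i \<le> k")
    case True
    have "pmf (map_pmf ((+) i) p) (i + (k - i)) = pmf p (k - i)"
      by (rule pmf_map_inj') (simp add: inj_def)
    with True show ?thesis by simp
  next
    case False
    then have "k \<notin> set_pmf (map_pmf ((+) i) p)" by auto
    then show ?thesis using False by (metis pmf_eq_0_set_pmf)
  qed
  have "ennreal (pmf (convolution_power ?T (Suc n)) k)
      = (\<Sum>i. ennreal (pmf ?T i * (if i \<le> k then pmf (convolution_power ?T n) (k - i) else 0)))"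
    by (simp add: ennreal_pmf_bind * nn_integral_measure_pmf nn_integral_count_space_nat ennreal_mult)
  also have "\<dots> = (\<Sum>i\<le>k. ennreal (pmf ?T i * (if i \<le> k then pmf (convolution_power ?T n) (k - i) else 0)))"
    by (intro suminf_finite) auto
  also have "\<dots> = ennreal (\<Sum>i\<le>k. pmf ?T i * pmf (convolution_power ?T n) (k - i))"
    by (subst sum_ennreal) (auto intro!: sum.cong arg_cong[where f = ennreal])
  finally show ?thesis by (simp add: sum_nonneg)
qed

text \<open>Splitting off the first step gives the renewal equation that
  \<open>subordinator_green\<close> satisfies. The increment has no mass at \<open>0\<close>, so the
  equation determines the value at \<open>k\<close> from smaller indices.\<close>

lemma subordinator_visits:
  "(\<Sum>n. ennreal (pmf (convolution_power (subordinator_incr \<alpha>) n) k)) = ennreal (subordinator_green (\<alpha> / 2) k)"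
proof (induction k rule: less_induct)
  case (less k)
  let ?T = "subordinator_incr \<alpha>" and ?g = "subordinator_green (\<alpha> / 2)"
  have nn: "0 \<le> ?g i" for i using subordinator_green_pos[of "\<alpha> / 2" i] \<alpha> by simp
  have "(\<Sum>n. ennreal (pmf (convolution_power ?T n) k))
      = ennreal (pmf (convolution_power ?T 0) k) + (\<Sum>n. ennreal (pmf (convolution_power ?T (Suc n)) k))"
    using suminf_offset[OF summableI, of "\<lambda>n. ennreal (pmf (convolution_power ?T n) k)" 1] by simp
  also have "(\<Sum>n. ennreal (pmf (convolution_power ?T (Suc n)) k))
      = (\<Sum>n. \<Sum>i\<le>k. ennreal (pmf ?T i) * ennreal (pmf (convolution_power ?T n) (k - i)))"
    unfolding pmf_subordinator_Suc by (simp add: ennreal_mult flip: sum_ennreal)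
  also have "\<dots> = (\<Sum>i\<le>k. ennreal (pmf ?T i) * (\<Sum>n. ennreal (pmf (convolution_power ?T n) (k - i))))"
    by (subst suminf_sum) (simp_all add: summableI)
  also have "\<dots> = (\<Sum>i\<le>k. ennreal (pmf ?T i * ?g (k - i)))"
  proof (intro sum.cong refl)
    fix i assume "i \<in> {..k}"
    show "ennreal (pmf ?T i) * (\<Sum>n. ennreal (pmf (convolution_power ?T n) (k - i))) = ennreal (pmf ?T i * ?g (k - i))"
    proof (cases "i = 0")
      case True
      then show ?thesis by (simp add: pmf_subordinator_incr)
    next
      case False
      with \<open>i \<in> {..k}\<close> have "k - i < k" by auto
      from less[OF this] show ?thesis by (simp add: ennreal_mult nn)
    qed
  qed
  also have "\<dots> = ennreal (\<Sum>i\<le>k. pmf ?T i * ?g (k - i))"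
    by (intro sum_ennreal) (simp add: nn)
  also have "ennreal (pmf (convolution_power ?T 0) k) + \<dots> = ennreal (?g k)"
    by (subst (2) subordinator_green_renewal, subst ennreal_plus[symmetric])
      (auto simp: nn pmf_return sum_nonneg)
  finally show ?case .
qed

text \<open>Condition on the subordinator and exchange the sums over \<open>n\<close> and
  \<open>k\<close>, all terms being nonnegative.\<close>

lemma stable_walk_visits:
  assumes "\<alpha> < 1"
  shows "(\<Sum>n. ennreal (pmf (convolution_power (stable_incr \<alpha>) n) y)) = ennreal (stable_green (\<alpha> / 2) y)"
proof -
  let ?T = "subordinator_incr \<alpha>" and ?g = "subordinator_green (\<alpha> / 2)"
  have \<beta>: "0 < \<alpha> / 2" "\<alpha> / 2 < 1 / 2" using assms \<alpha> by auto
  have nn: "0 \<le> ?g i" for i using subordinator_green_pos[of "\<alpha> / 2" i] \<alpha> by simp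
  have "(\<Sum>n. ennreal (pmf (convolution_power (stable_incr \<alpha>) n) y))
      = (\<Sum>n. \<integral>\<^sup>+k. ennreal (pmf (convolution_power ?T n) k) * ennreal (srw_step_prob k y) \<partial>count_space UNIV)"
    by (simp add: stable_incr_eq convolution_power_subordination ennreal_pmf_bind pmf_srw nn_integral_measure_pmf)
  also have "\<dots> = (\<integral>\<^sup>+k. (\<Sum>n. ennreal (pmf (convolution_power ?T n) k) * ennreal (srw_step_prob k y)) \<partial>count_space UNIV)"
    by (intro nn_integral_suminf[symmetric]) simp
  also have "\<dots> = (\<Sum>k. ennreal (?g k * srw_step_prob k y))"
    by (simp add: nn_integral_count_space_nat subordinator_visits ennreal_mult nn srw_step_prob_nonneg)
  also have "\<dots> = ennreal (stable_green (\<alpha> / 2) y)"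
    unfolding stable_green_def
    using stable_green_summable[OF \<beta>] nn srw_step_prob_nonneg by (intro suminf_ennreal2) auto
  finally show ?thesis .
qed

end

section \<open>Hitting probabilities\<close>

lemma walk_pos_0 [simp]: "walk_pos x \<omega> 0 = x"
  by (simp add: walk_pos_def)

lemma walk_pos_SCons_Suc [simp]: "walk_pos x (z ## \<omega>) (Suc n) = walk_pos (x + z) \<omega> n"
  by (simp add: walk_pos_def)

context
  fixes p :: "int pmf"
begin

abbreviation "paths \<equiv> stream_space (measure_pmf p)"

lemma prob_space_paths: "prob_space paths"
  by (rule prob_space.prob_space_stream_space[OF prob_space_measure_pmf])

lemma space_paths: "space paths = UNIV"
  by (simp add: space_stream_space)

lemma walk_pos_measurable [measurable]: "(\<lambda>\<omega>. walk_pos x \<omega> n) \<in> measurable paths (count_space UNIV)"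
proof -
  have "sets paths = sets (stream_space (count_space UNIV))"
    by (rule sets_stream_space_cong) simp
  then have "stake n \<in> measurable paths (count_space UNIV)"
    using measurable_stake measurable_cong_sets by blast
  then show ?thesis
    unfolding walk_pos_def by (rule measurable_compose) simp
qed

lemma walk_events [measurable]:
  "{\<omega>. walk_pos x \<omega> n \<in> B} \<in> sets paths"
  "{\<omega>. \<exists>n. walk_pos x \<omega> n \<in> B} \<in> sets paths"
  "{\<omega>. \<forall>n. walk_pos x \<omega> n \<notin> B} \<in> sets paths"
  "{\<omega>. \<forall>i<n. walk_pos x \<omega> i \<notin> B} \<in> sets paths"
proof -
  have "{\<omega> \<in> space paths. walk_pos x \<omega> n \<in> B} \<in> sets paths"
    "{\<omega> \<in> space paths. \<exists>n. walk_pos x \<omega> n \<in> B} \<in> sets paths"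
    "{\<omega> \<in> space paths. \<forall>n. walk_pos x \<omega> n \<notin> B} \<in> sets paths"
    "{\<omega> \<in> space paths. \<forall>i<n. walk_pos x \<omega> i \<notin> B} \<in> sets paths"
    by measurable
  then show "{\<omega>. walk_pos x \<omega> n \<in> B} \<in> sets paths"
    "{\<omega>. \<exists>n. walk_pos x \<omega> n \<in> B} \<in> sets paths"
    "{\<omega>. \<forall>n. walk_pos x \<omega> n \<notin> B} \<in> sets paths"
    "{\<omega>. \<forall>i<n. walk_pos x \<omega> i \<notin> B} \<in> sets paths"
    by (simp_all add: space_paths)
qed

text \<open>First-step form of the Markov property.\<close>

lemma emeasure_paths_step:
  "A \<in> sets paths \<Longrightarrow> emeasure paths A = (\<integral>\<^sup>+z. emeasure paths {\<omega>. z ## \<omega> \<in> A} \<partial>p)"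
  using prob_space.emeasure_stream_space[OF prob_space_measure_pmf, of A p] by (simp add: space_paths)

lemma emeasure_paths_UNIV: "emeasure paths UNIV = 1"
  using prob_space.emeasure_space_1[OF prob_space_paths] by (simp add: space_paths)

lemma emeasure_walk_pos:
  "emeasure paths {\<omega>. walk_pos x \<omega> n \<in> {y}} = pmf (convolution_power p n) (y - x)"
proof (induction n arbitrary: x)
  case 0
  show ?case by (simp add: pmf_return emeasure_paths_UNIV)
next
  case (Suc n)
  have "emeasure paths {\<omega>. walk_pos x \<omega> (Suc n) \<in> {y}}
      = (\<integral>\<^sup>+z. emeasure paths {\<omega>. walk_pos (x + z) \<omega> n \<in> {y}} \<partial>p)"
    by (subst emeasure_paths_step[OF walk_events(1)]) simp
  also have "\<dots> = pmf (convolution_power p (Suc n)) (y - x)"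
    unfolding Suc pmf_convolution_power_Suc by (simp add: algebra_simps)
  finally show ?case .
qed

text \<open>The start lies outside \<open>B\<close> because time \<open>0\<close> counts as a visit;
  the same holds for the two avoidance versions below.\<close>

lemma hitting_step:
  assumes "x \<notin> B"
  shows "emeasure paths {\<omega>. \<exists>n. walk_pos x \<omega> n \<in> B} = (\<integral>\<^sup>+z. emeasure paths {\<omega>. \<exists>n. walk_pos (x + z) \<omega> n \<in> B} \<partial>p)"
proof -
  have "(\<exists>n. walk_pos x (z ## \<omega>) n \<in> B) \<longleftrightarrow> (\<exists>n. walk_pos (x + z) \<omega> n \<in> B)" for z \<omega>
    using assms by (metis not0_implies_Suc walk_pos_0 walk_pos_SCons_Suc)
  then show ?thesis by (subst emeasure_paths_step[OF walk_events(2)]) simp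
qed

lemma avoiding_step:
  assumes "x \<notin> B"
  shows "emeasure paths {\<omega>. \<forall>n. walk_pos x \<omega> n \<notin> B} = (\<integral>\<^sup>+z. emeasure paths {\<omega>. \<forall>n. walk_pos (x + z) \<omega> n \<notin> B} \<partial>p)"
proof -
  have "(\<forall>n. walk_pos x (z ## \<omega>) n \<notin> B) \<longleftrightarrow> (\<forall>n. walk_pos (x + z) \<omega> n \<notin> B)" for z \<omega>
    using assms by (metis not0_implies_Suc walk_pos_0 walk_pos_SCons_Suc)
  then show ?thesis by (subst emeasure_paths_step[OF walk_events(3)]) simp
qed

lemma avoiding_until_step:
  assumes "x \<notin> B"
  shows "emeasure paths {\<omega>. \<forall>i<Suc n. walk_pos x \<omega> i \<notin> B} = (\<integral>\<^sup>+z. emeasure paths {\<omega>. \<forall>i<n. walk_pos (x + z) \<omega> i \<notin> B} \<partial>p)"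
  using assms by (subst emeasure_paths_step[OF walk_events(4)]) (simp add: All_less_Suc2)

section \<open>Visits against hitting probabilities\<close>

text \<open>Union bound over points and times.\<close>

lemma hitting_le_visits:
  fixes a :: "nat \<Rightarrow> int"
  shows "emeasure paths {\<omega>. \<exists>n. walk_pos x \<omega> n \<in> range a}
    \<le> (\<Sum>k. \<Sum>n. ennreal (pmf (convolution_power p n) (a k - x)))"
proof -
  have sets: "{\<omega>. walk_pos x \<omega> n \<in> {y}} \<in> sets paths" "(\<Union>n. {\<omega>. walk_pos x \<omega> n \<in> {y}}) \<in> sets paths" for n y
    using walk_events(1) by (blast, intro sets.countable_UN) blast
  have "{\<omega>. \<exists>n. walk_pos x \<omega> n \<in> range a} = (\<Union>k. \<Union>n. {\<omega>. walk_pos x \<omega> n \<in> {a k}})"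
    by auto
  also have "emeasure paths \<dots> \<le> (\<Sum>k. emeasure paths (\<Union>n. {\<omega>. walk_pos x \<omega> n \<in> {a k}}))"
    by (rule emeasure_subadditive_countably) (use sets in blast)
  also have "\<dots> \<le> (\<Sum>k. \<Sum>n. emeasure paths {\<omega>. walk_pos x \<omega> n \<in> {a k}})"
    by (intro suminf_le summableI emeasure_subadditive_countably) (use sets in blast)
  finally show ?thesis unfolding emeasure_walk_pos .
qed

text \<open>A maximum principle standing in for the strong Markov property at the first visit to \<open>F\<close>:
  both sides are harmonic outside \<open>F\<close>, and \<open>M\<close> dominates on \<open>F\<close>.\<close>
lemma visits_le_hitting:
  fixes F :: "int set"
  defines "visits \<equiv> \<lambda>x. \<Sum>b\<in>F. \<Sum>n. ennreal (pmf (convolution_power p n) (b - x))"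
  assumes "finite F" and M: "\<And>y. y \<in> F \<Longrightarrow> visits y \<le> M"
  shows "visits x \<le> M * emeasure paths {\<omega>. \<exists>n. walk_pos x \<omega> n \<in> F}"
proof -
  define q where "q n x = (\<Sum>b\<in>F. ennreal (pmf (convolution_power p n) (b - x)))" for n x
  let ?h = "\<lambda>x. emeasure paths {\<omega>. \<exists>n. walk_pos x \<omega> n \<in> F}"
  have visits: "visits x = (\<Sum>n. q n x)" for x
    unfolding visits_def q_def by (subst suminf_sum) (simp_all add: summableI)
  have q_Suc: "q (Suc n) x = (\<integral>\<^sup>+z. q n (x + z) \<partial>p)" for n x
  proof -
    have "- z + (b - x) = b - (x + z)" for z b by simp
    then show ?thesis
      unfolding q_def pmf_convolution_power_Suc by (simp only:) (rule nn_integral_sum[symmetric], simp)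
  qed
  \<comment> \<open>Truncating the visits at time \<open>n\<close> turns the comparison into an
    induction on \<open>n\<close>.\<close>
  have "(\<Sum>i<n. q i x) \<le> M * ?h x" for n
  proof (induction n arbitrary: x)
    case (Suc n)
    show ?case
    proof (cases "x \<in> F")
      case True
      then have "{\<omega>. \<exists>n. walk_pos x \<omega> n \<in> F} = UNIV"
        by (auto intro: exI[of _ 0])
      then have "?h x = 1" by (simp add: emeasure_paths_UNIV)
      moreover have "(\<Sum>i<Suc n. q i x) \<le> visits x"
        unfolding visits by (intro sum_le_suminf summableI) auto
      ultimately show ?thesis using M[OF True] by simp
    next
      case False
      then have "q 0 x = 0"
        unfolding q_def by (intro sum.neutral) (auto simp: pmf_return indicator_def)
      then have "(\<Sum>i<Suc n. q i x) = (\<integral>\<^sup>+z. (\<Sum>i<n. q i (x + z)) \<partial>p)"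
        by (simp only: sum.lessThan_Suc_shift q_Suc) (simp add: nn_integral_sum)
      also have "\<dots> \<le> (\<integral>\<^sup>+z. M * ?h (x + z) \<partial>p)"
        by (intro nn_integral_mono Suc)
      also have "\<dots> = M * ?h x"
        unfolding hitting_step[OF False] by (rule nn_integral_cmult) simp
      finally show ?thesis .
    qed
  qed simp
  then show ?thesis unfolding visits by (intro suminf_le_const summableI)
qed

text \<open>By the Markov property at time \<open>n\<close>, the avoidance probability v is at most
  1 - \<delta> times the probability of avoiding \<open>B\<close> before time \<open>n\<close>. The
  latter decreases to v, so v \<le> (1 - \<delta>) v and v = 0.\<close>

lemma uniform_hitting_imp_AE:
  assumes "0 < \<delta>" and hit: "\<And>x. ennreal \<delta> \<le> emeasure paths {\<omega>. \<exists>n. walk_pos x \<omega> n \<in> B}"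
  shows "AE \<omega> in paths. \<exists>n. walk_pos x \<omega> n \<in> B"
proof -
  interpret prob_space paths by (rule prob_space_paths)
  let ?v = "\<lambda>x. emeasure paths {\<omega>. \<forall>n. walk_pos x \<omega> n \<notin> B}"
  let ?w = "\<lambda>n x. emeasure paths {\<omega>. \<forall>i<n. walk_pos x \<omega> i \<notin> B}"
  have v_le: "?v x \<le> ennreal (1 - \<delta>)" for x
  proof -
    have "ennreal \<delta> \<le> ennreal (prob {\<omega>. \<exists>n. walk_pos x \<omega> n \<in> B})"
      using hit by (simp add: emeasure_eq_measure)
    then have "\<delta> \<le> prob {\<omega>. \<exists>n. walk_pos x \<omega> n \<in> B}"
      by (subst (asm) ennreal_le_iff) auto
    moreover have "prob (space paths - {\<omega>. \<exists>n. walk_pos x \<omega> n \<in> B}) = 1 - prob {\<omega>. \<exists>n. walk_pos x \<omega> n \<in> B}"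
      by (rule prob_compl[OF walk_events(2)])
    moreover have "space paths - {\<omega>. \<exists>n. walk_pos x \<omega> n \<in> B} = {\<omega>. \<forall>n. walk_pos x \<omega> n \<notin> B}"
      by (auto simp: space_paths)
    ultimately show ?thesis by (simp add: emeasure_eq_measure ennreal_leI)
  qed
  have le: "?v x \<le> ennreal (1 - \<delta>) * ?w n x" for n x
  proof (induction n arbitrary: x)
    case 0
    show ?case using v_le by (simp add: emeasure_paths_UNIV)
  next
    case (Suc n)
    show ?case
    proof (cases "x \<in> B")
      case True
      then have "{\<omega>. \<forall>n. walk_pos x \<omega> n \<notin> B} = {}"
        by (auto intro!: exI[of _ 0])
      then have "?v x = 0" by (simp only: emeasure_empty)
      then show ?thesis by (simp only: zero_le)
    next
      case False
      have "?v x \<le> (\<integral>\<^sup>+z. ennreal (1 - \<delta>) * ?w n (x + z) \<partial>p)"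
        unfolding avoiding_step[OF False] by (intro nn_integral_mono Suc)
      also have "\<dots> = ennreal (1 - \<delta>) * ?w (Suc n) x"
        unfolding avoiding_until_step[OF False] by (rule nn_integral_cmult) simp
      finally show ?thesis .
    qed
  qed
  have "(\<lambda>n. ?w n x) \<longlonglongrightarrow> emeasure paths (\<Inter>n. {\<omega>. \<forall>i<n. walk_pos x \<omega> i \<notin> B})"
    by (rule Lim_emeasure_decseq) (auto simp: decseq_def emeasure_eq_measure intro: walk_events(4))
  also have "(\<Inter>n. {\<omega>. \<forall>i<n. walk_pos x \<omega> i \<notin> B}) = {\<omega>. \<forall>n. walk_pos x \<omega> n \<notin> B}"
    by blast
  finally have "(\<lambda>n. ennreal (1 - \<delta>) * ?w n x) \<longlonglongrightarrow> ennreal (1 - \<delta>) * ?v x"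
    by (intro ennreal_tendsto_cmult) auto
  then have "?v x \<le> ennreal (1 - \<delta>) * ?v x"
    by (rule LIMSEQ_le_const) (use le in auto)
  then have "?v x = 0"
  proof (cases "\<delta> \<le> 1")
    case True
    assume "?v x \<le> ennreal (1 - \<delta>) * ?v x"
    then have "prob {\<omega>. \<forall>n. walk_pos x \<omega> n \<notin> B} \<le> (1 - \<delta>) * prob {\<omega>. \<forall>n. walk_pos x \<omega> n \<notin> B}"
      using True by (simp add: emeasure_eq_measure flip: ennreal_mult)
    then have "\<delta> * prob {\<omega>. \<forall>n. walk_pos x \<omega> n \<notin> B} \<le> 0" by (simp add: algebra_simps)
    then show ?thesis using assms(1) by (simp add: emeasure_eq_measure mult_le_0_iff measure_le_0_iff)
  \<comment> \<open>For \<delta> > 1, \<open>ennreal\<close> truncates \<open>1 - \<delta>\<close>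
    to \<open>0\<close>.\<close>
  qed (simp add: ennreal_neg)
  then show ?thesis
    by (intro AE_I[where N = "{\<omega>. \<forall>n. walk_pos x \<omega> n \<notin> B}"]) (use walk_events(3) in auto)
qed

end


section \<open>Massive superlinear sets\<close>

theorem theorem2p1:
  fixes \<alpha> :: real and a :: "nat \<Rightarrow> int"
  assumes "0 < \<alpha>" and "\<alpha> < 1"
    and pos: "\<forall>n\<ge>1. a n > 0"
    and incr: "\<forall>n m. 1 \<le> n \<longrightarrow> n < m \<longrightarrow> a n < a m"
    and superlin: "\<forall>n k. 0 < k \<longrightarrow> k < n \<longrightarrow> a n \<ge> a (n - k) + a k"
  shows "stable_massive \<alpha> {a n | n. n \<ge> 1} \<longleftrightarrow>
         \<not> summable (\<lambda>n. 1 / (real_of_int (a (Suc n))) powr (1 - \<alpha>))"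
proof -
  define b where "b k = a (Suc k)" for k
  define f where "f k = real_of_int (b k) powr (\<alpha> - 1)" for k
  define G where "G = stable_green (\<alpha> / 2)"
  let ?p = "stable_incr \<alpha>"
  interpret prob_space "paths ?p" by (rule prob_space_paths)
  have range: "{a n | n. n \<ge> 1} = range b"
  proof (intro equalityI subsetI)
    fix y assume "y \<in> {a n | n. n \<ge> 1}"
    then obtain n where "y = a n" "n \<ge> 1" by blast
    then have "y = b (n - 1)" by (simp add: b_def)
    then show "y \<in> range b" by simp
  qed (auto simp: b_def)
  have f_eq: "(\<lambda>n. 1 / (real_of_int (a (Suc n))) powr (1 - \<alpha>)) = f"
    by (auto simp: f_def b_def simp flip: powr_minus_divide)
  have b_ge: "b k \<ge> int k + 1" for k
  proof (induction k)
    case 0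
    show ?case using pos[rule_format, of 1] by (simp add: b_def)
  next
    case (Suc k)
    have "b k < b (Suc k)" using incr by (simp add: b_def)
    with Suc show ?case by simp
  qed
  have inj: "inj b"
    by (rule strict_mono_imp_inj_on) (use incr in \<open>auto simp: strict_mono_def b_def\<close>)
  \<comment> \<open>Superlinearity for the indices \<open>Suc k\<close> and \<open>k - j\<close>;
    the argument \<open>k - Suc j\<close> arises from
    \<open>a (k - j) = b (k - Suc j)\<close>.\<close>
  have b_gap: "b k \<ge> b j + b (k - Suc j)" if "j < k" for j k
    using superlin[rule_format, of "k - j" "Suc k"] that by (simp add: b_def Suc_diff_Suc)
  have f_nonneg: "f k \<ge> 0" for k by (simp add: f_def)
  have \<beta>: "0 < \<alpha> / 2" "\<alpha> / 2 < 1 / 2" and \<alpha>: "0 < \<alpha>" "\<alpha> < 2" using assms by auto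
  obtain c C where cC: "0 < c" "0 < C"
    and G_ge': "\<And>x. x \<noteq> 0 \<Longrightarrow> c * real_of_int \<bar>x\<bar> powr (2 * (\<alpha> / 2) - 1) \<le> stable_green (\<alpha> / 2) x"
    and G_le': "\<And>x. x \<noteq> 0 \<Longrightarrow> stable_green (\<alpha> / 2) x \<le> C * real_of_int \<bar>x\<bar> powr (2 * (\<alpha> / 2) - 1)"
    by (rule stable_green_bounds[OF \<beta>]) (rule that)
  \<comment> \<open>The exponent \<alpha> - 1 is negative, so upper bounds on the distance give
    lower bounds on \<open>G\<close>, and conversely in \<open>G_le\<close>.\<close>
  have G_ge: "c * r powr (\<alpha> - 1) \<le> G x" if "x \<noteq> 0" "real_of_int \<bar>x\<bar> \<le> r" for x r
  proof -
    have "r powr (\<alpha> - 1) \<le> real_of_int \<bar>x\<bar> powr (\<alpha> - 1)"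
      using that assms by (intro powr_mono2') auto
    then have "c * r powr (\<alpha> - 1) \<le> c * real_of_int \<bar>x\<bar> powr (\<alpha> - 1)"
      using cC by (intro mult_left_mono) auto
    then show ?thesis using G_ge'[OF that(1)] by (simp add: G_def)
  qed
  have G_le: "G x \<le> C * r powr (\<alpha> - 1)" if "0 < r" "r \<le> real_of_int \<bar>x\<bar>" for x r
  proof -
    have "real_of_int \<bar>x\<bar> powr (\<alpha> - 1) \<le> r powr (\<alpha> - 1)"
      using that assms by (intro powr_mono2') auto
    then have "C * real_of_int \<bar>x\<bar> powr (\<alpha> - 1) \<le> C * r powr (\<alpha> - 1)"
      using cC by (intro mult_left_mono) auto
    moreover have "x \<noteq> 0" using that by auto
    ultimately show ?thesis using G_le'[of x] by (simp add: G_def)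
  qed
  have G_nonneg: "G x \<ge> 0" for x unfolding G_def by (rule stable_green_nonneg[OF \<beta>])
  have visits: "(\<Sum>n. ennreal (pmf (convolution_power ?p n) y)) = ennreal (G y)" for y
    unfolding G_def by (rule stable_walk_visits[OF \<alpha> assms(2)])
  have massive: "stable_massive \<alpha> {a n | n. n \<ge> 1} \<longleftrightarrow>
      (\<forall>x. AE \<omega> in paths ?p. \<exists>n. walk_pos x \<omega> n \<in> range b)"
    unfolding stable_massive_def stable_walk_space_def range ..
  show ?thesis unfolding massive f_eq
  proof

    \<comment> \<open>Convergent series: starting far to the left\<close>
    assume hit: "\<forall>x. AE \<omega> in paths ?p. \<exists>n. walk_pos x \<omega> n \<in> range b"
    show "\<not> summable f"
    proof
      assume summable: "summable f"
      define g where "g k N = C * (real_of_int (b k) + real N) powr (\<alpha> - 1)" for k N :: nat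
      have g_le: "g k N \<le> C * f k" for k N
        unfolding g_def f_def using b_ge[of k] cC assms
        by (intro mult_left_mono powr_mono2') auto
      have g_nonneg: "g k N \<ge> 0" for k N unfolding g_def using cC by simp
      have "((\<lambda>N. g k N) \<longlongrightarrow> C * 0) sequentially" for k
        unfolding g_def using assms
        by (intro tendsto_mult tendsto_const tendsto_neg_powr
              filterlim_tendsto_add_at_top[OF tendsto_const] filterlim_real_sequentially) auto
      then have lim: "((\<lambda>N. g k N) \<longlongrightarrow> 0) sequentially" for k by simp
      have "norm (g k N) \<le> C * f k" for k N
        using g_le g_nonneg by simp
      then have dominated: "\<forall>\<^sub>F (k, N) in at_top \<times>\<^sub>F sequentially. norm (g k N) \<le> C * f k"
        by (intro always_eventually) auto
      have "((\<lambda>N. \<Sum>k. g k N) \<longlongrightarrow> (\<Sum>k. 0)) sequentially"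
        using tannerys_theorem[OF lim dominated summable_mult[OF summable] sequentially_bot] by blast
      then have "\<forall>\<^sub>F N in sequentially. (\<Sum>k. g k N) < 1"
        by (rule order_tendstoD(2)) simp
      then obtain N where N: "(\<Sum>k. g k N) < 1"
        unfolding eventually_sequentially by blast
      have "summable (\<lambda>k. g k N)"
        by (rule summable_comparison_test'[OF summable_mult[OF summable, of C], of 0]) (use g_le g_nonneg in simp)
      have "1 = emeasure (paths ?p) {\<omega>. \<exists>n. walk_pos (- int N) \<omega> n \<in> range b}"
        using emeasure_eq_1_AE[OF walk_events(2)] hit by fastforce
      also have "\<dots> \<le> (\<Sum>k. ennreal (G (b k - - int N)))"
        using hitting_le_visits[of ?p "- int N" b] unfolding visits .
      also have "\<dots> \<le> (\<Sum>k. ennreal (g k N))"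
      proof (intro suminf_le summableI ennreal_leI)
        fix k
        show "G (b k - - int N) \<le> g k N"
          unfolding g_def using b_ge[of k] by (intro G_le) auto
      qed
      also have "\<dots> = ennreal (\<Sum>k. g k N)"
        by (rule suminf_ennreal2[OF g_nonneg \<open>summable (\<lambda>k. g k N)\<close>])
      finally show False using N by simp
    qed
  next

    \<comment> \<open>Divergent series: a uniform hitting probability\<close>
    assume div: "\<not> summable f"
    define S where "S m = (\<Sum>k<m. f k)" for m
    \<comment> \<open>The factor 2^(\<alpha> - 1) accounts for |b_k - x| \<le> 2 b_k once b_k >
      |x|.\<close>
    define c' where "c' = c * 2 powr (\<alpha> - 1)"
    have c': "c' > 0" using cC by (simp add: c'_def)
    have S_nonneg: "S m \<ge> 0" for m unfolding S_def by (intro sum_nonneg f_nonneg)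
    have S_mono: "S m \<le> S n" if "m \<le> n" for m n
      unfolding S_def using that f_nonneg by (intro sum_mono2) auto
    have S_unbounded: "\<exists>m. S m > X" for X
      using div summableI_nonneg_bounded[of f X] f_nonneg unfolding S_def by (meson not_le)
    \<comment> \<open>On either side of \<open>b j\<close> the distances dominate
      \<open>b 0\<close>, \<open>b 1\<close>, and so on, by \<open>b_gap\<close>; each side
      contributes at most \<open>C * S m\<close>.\<close>
    have above: "(\<Sum>k<m. G (b k - b j)) \<le> G 0 + 2 * C * S m" if "j < m" for j m
    proof -
      have split: "(\<Sum>k<m. G (b k - b j)) = (\<Sum>k<j. G (b k - b j)) + G 0 + (\<Sum>k=Suc j..<m. G (b k - b j))"
        using that sum.atLeastLessThan_concat[of 0 "Suc j" m "\<lambda>k. G (b k - b j)"]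
        by (simp add: atLeast0LessThan)
      have "(\<Sum>k<j. G (b k - b j)) \<le> (\<Sum>k<j. C * f (j - Suc k))"
      proof (intro sum_mono)
        fix k assume "k \<in> {..<j}"
        then show "G (b k - b j) \<le> C * f (j - Suc k)"
          unfolding f_def using b_gap[of k j] b_ge[of "j - Suc k"] by (intro G_le) auto
      qed
      also have "\<dots> = C * S j"
        by (simp add: S_def sum.nat_diff_reindex flip: sum_distrib_left)
      also have "\<dots> \<le> C * S m" using that cC by (intro mult_left_mono S_mono) auto
      finally have 1: "(\<Sum>k<j. G (b k - b j)) \<le> C * S m" .
      have "(\<Sum>k=Suc j..<m. G (b k - b j)) \<le> (\<Sum>k=Suc j..<m. C * f (k - Suc j))"
      proof (intro sum_mono)
        fix k assume "k \<in> {Suc j..<m}"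
        then show "G (b k - b j) \<le> C * f (k - Suc j)"
          unfolding f_def using b_gap[of j k] b_ge[of "k - Suc j"] by (intro G_le) auto
      qed
      also have "\<dots> = C * S (m - Suc j)"
        using sum.atLeastLessThan_shift_0[of "\<lambda>k. C * f (k - Suc j)" "Suc j" m]
        by (simp add: S_def atLeast0LessThan flip: sum_distrib_left)
      also have "\<dots> \<le> C * S m" using cC by (intro mult_left_mono S_mono) auto
      finally show ?thesis unfolding split using 1 by simp
    qed
    \<comment> \<open>Indices from \<open>nat \<bar>x\<bar>\<close> on satisfy b_k > |x|; discarding
      the earlier ones costs a constant independent of \<open>m\<close>.\<close>
    have below: "c' * S m - c' * S (nat \<bar>x\<bar>) \<le> (\<Sum>k<m. G (b k - x))" for m x
    proof -
      let ?N = "nat \<bar>x\<bar>"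
      have term_le: "c' * f k \<le> G (b k - x)" if "?N \<le> k" for k
      proof -
        have "b k > \<bar>x\<bar>" using b_ge[of k] that by linarith
        then have "c * (2 * real_of_int (b k)) powr (\<alpha> - 1) \<le> G (b k - x)"
          by (intro G_ge) auto
        moreover have "(2 * real_of_int (b k)) powr (\<alpha> - 1) = 2 powr (\<alpha> - 1) * f k"
          unfolding f_def using b_ge[of k] by (simp add: powr_mult)
        ultimately show ?thesis by (simp add: c'_def mult.assoc)
      qed
      have "c' * S m \<le> c' * (S ?N + (\<Sum>k\<in>{?N..<m}. f k))"
        unfolding S_def using c' f_nonneg
        by (intro mult_left_mono, subst sum.union_disjoint[symmetric]) (auto intro!: sum_mono2)
      also have "\<dots> = c' * S ?N + (\<Sum>k\<in>{?N..<m}. c' * f k)"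
        by (simp add: distrib_left sum_distrib_left)
      also have "(\<Sum>k\<in>{?N..<m}. c' * f k) \<le> (\<Sum>k\<in>{?N..<m}. G (b k - x))"
        by (intro sum_mono term_le) auto
      also have "\<dots> \<le> (\<Sum>k<m. G (b k - x))"
        by (intro sum_mono2 G_nonneg) auto
      finally show ?thesis by simp
    qed
    \<comment> \<open>Half of c' / (2 C), the limit of the quotient of the two visit bounds. A
      smaller hitting probability would give c' S \<le> const + (c' / 2) S and so bound the partial
      sums.\<close>
    have "ennreal (c' / (4 * C)) \<le> emeasure (paths ?p) {\<omega>. \<exists>n. walk_pos x \<omega> n \<in> range b}" for x
    proof (rule ccontr)
      let ?h = "prob {\<omega>. \<exists>n. walk_pos x \<omega> n \<in> range b}"
      assume "\<not> ?thesis"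
      then have "?h < c' / (4 * C)"
        using c' cC by (simp add: emeasure_eq_measure ennreal_less_iff not_le)
      then have h: "2 * C * ?h \<le> c' / 2" "0 \<le> ?h" "?h \<le> 1"
        using cC by (auto simp: field_simps)
      have "c' * S m - c' * S (nat \<bar>x\<bar>) \<le> (G 0 + 2 * C * S m) * ?h" for m
      proof -
        \<comment> \<open>A finite piece of the set keeps the expected visits finite, with
          \<open>above\<close> as the bound on \<open>?F\<close>.\<close>
        let ?F = "b ` {..<m}"
        have reindex: "(\<Sum>y\<in>?F. ennreal (G (y - z))) = ennreal (\<Sum>k<m. G (b k - z))" for z
          using inj G_nonneg by (subst sum.reindex) (auto simp: sum_ennreal intro: inj_on_subset)
        have "ennreal (\<Sum>k<m. G (b k - x)) \<le> ennreal (G 0 + 2 * C * S m) * emeasure (paths ?p) {\<omega>. \<exists>n. walk_pos x \<omega> n \<in> ?F}"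
          unfolding reindex[symmetric] visits[symmetric]
          by (rule visits_le_hitting) (auto simp: visits reindex intro!: ennreal_leI above)
        also have "\<dots> \<le> ennreal (G 0 + 2 * C * S m) * ennreal ?h"
          unfolding emeasure_eq_measure[symmetric]
          by (intro mult_left_mono emeasure_mono walk_events) auto
        also have "\<dots> = ennreal ((G 0 + 2 * C * S m) * ?h)"
          using G_nonneg cC S_nonneg by (intro ennreal_mult[symmetric]) auto
        finally have "(\<Sum>k<m. G (b k - x)) \<le> (G 0 + 2 * C * S m) * ?h"
          using G_nonneg cC S_nonneg by (subst (asm) ennreal_le_iff) auto
        with below[of m x] show ?thesis by linarith
      qed
      moreover have "2 * C * S m * ?h \<le> c' / 2 * S m" for m
        using mult_right_mono[OF h(1) S_nonneg[of m]] by (simp add: mult_ac)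
      moreover have "G 0 * ?h \<le> G 0" using h G_nonneg[of 0] by (simp add: mult_left_le)
      ultimately have "c' / 2 * S m \<le> c' * S (nat \<bar>x\<bar>) + G 0" for m
        by (smt (verit) distrib_right field_sum_of_halves)
      then have "S m \<le> (c' * S (nat \<bar>x\<bar>) + G 0) / (c' / 2)" for m
        using c' by (simp add: field_simps)
      with S_unbounded show False by (meson not_le)
    qed
    then show "\<forall>x. AE \<omega> in paths ?p. \<exists>n. walk_pos x \<omega> n \<in> range b"
      using uniform_hitting_imp_AE[of "c' / (4 * C)" ?p "range b"] c' cC by simp
  qed
qed

end
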